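(* Let $\tau$ be a finite unary vocabulary and $\mathfrak{M}$ a $\tau$-model of size $n$. Let $T = \{\pi_1,\dots,\pi_\ell\}$ be the types realized in $\mathfrak{M}$, enumerated so that $|\pi_1|\leq\dots\leq|\pi_\ell|$. Then $C(\mathfrak{M}) \geq 3|\pi_{\ell-1}| - 3$.
   Context: A $\tau$-model of size $n$ has domain $\{1,\dots,n\}$ and interprets each unary symbol of $\tau$ as a subset. A $\tau$-type is a subset $\pi\subseteq\tau$; $|\pi|$ is the number of points of $\mathfrak{M}$ belonging to exactly the relations named in $\pi$. $\mathrm{FO}[\tau]$-formulas (atoms $x=y$, $P(x)$; $\neg,\lor,\land,\exists,\forall$) are in negation normal form; the size of a formula is the number of atomic formulas (negated or not), conjunctions, disjunctions and quantifiers, negations not counted. A sentence defines $\mathfrak{M}$ if among $\tau$-models of size $n$ exactly those isomorphic to $\mathfrak{M}$ satisfy it; $C(\mathfrak{M})$ is the minimum size of an $\mathrm{FO}[\tau]$-formula defining $\mathfrak{M}$. *)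

theory Defs
  imports Main
begin

text \<open>
  A model of size \<open>n\<close> has domain \<open>{1..n}\<close> and is represented by the interpretation
  \<open>M :: 'p \<Rightarrow> nat set\<close> of its unary symbols; \<open>n\<close> and the vocabulary \<open>\<tau>\<close> are passed
  separately. The values of \<open>M\<close> outside \<open>\<tau>\<close> carry no information: neither isomorphism nor
  the formulas over \<open>\<tau>\<close> look at them.
\<close>

definition is_model :: "'p set \<Rightarrow> nat \<Rightarrow> ('p \<Rightarrow> nat set) \<Rightarrow> bool" where
  "is_model \<tau> n M \<longleftrightarrow> (\<forall>P\<in>\<tau>. M P \<subseteq> {1..n})"

definition isomorphic_models ::
    "'p set \<Rightarrow> nat \<Rightarrow> ('p \<Rightarrow> nat set) \<Rightarrow> ('p \<Rightarrow> nat set) \<Rightarrow> bool" where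
  "isomorphic_models \<tau> n M N \<longleftrightarrow>
    (\<exists>f. bij_betw f {1..n} {1..n} \<and> (\<forall>P\<in>\<tau>. \<forall>x\<in>{1..n}. x \<in> M P \<longleftrightarrow> f x \<in> N P))"

definition type_points :: "'p set \<Rightarrow> nat \<Rightarrow> ('p \<Rightarrow> nat set) \<Rightarrow> 'p set \<Rightarrow> nat set" where
  "type_points \<tau> n M \<pi> = {x \<in> {1..n}. \<forall>P\<in>\<tau>. x \<in> M P \<longleftrightarrow> P \<in> \<pi>}"

definition type_count :: "'p set \<Rightarrow> nat \<Rightarrow> ('p \<Rightarrow> nat set) \<Rightarrow> 'p set \<Rightarrow> nat" where
  "type_count \<tau> n M \<pi> = card (type_points \<tau> n M \<pi>)"

definition realized_types :: "'p set \<Rightarrow> nat \<Rightarrow> ('p \<Rightarrow> nat set) \<Rightarrow> 'p set set" where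
  "realized_types \<tau> n M = {\<pi>. \<pi> \<subseteq> \<tau> \<and> type_points \<tau> n M \<pi> \<noteq> {}}"

text \<open>
  Formulas are in negation normal form by construction, with natural numbers as variables.
\<close>

datatype 'p atom = Eq nat nat | Rel 'p nat

datatype 'p fo =
    Pos "'p atom"
  | Neg "'p atom"
  | Conj "'p fo" "'p fo"
  | Disj "'p fo" "'p fo"
  | Exists nat "'p fo"
  | Forall nat "'p fo"

primrec atom_vars :: "'p atom \<Rightarrow> nat set" where
  "atom_vars (Eq x y) = {x, y}"
| "atom_vars (Rel P x) = {x}"

primrec atom_symbols :: "'p atom \<Rightarrow> 'p set" where
  "atom_symbols (Eq x y) = {}"
| "atom_symbols (Rel P x) = {P}"

primrec free_vars :: "'p fo \<Rightarrow> nat set" where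
  "free_vars (Pos a) = atom_vars a"
| "free_vars (Neg a) = atom_vars a"
| "free_vars (Conj \<phi> \<psi>) = free_vars \<phi> \<union> free_vars \<psi>"
| "free_vars (Disj \<phi> \<psi>) = free_vars \<phi> \<union> free_vars \<psi>"
| "free_vars (Exists x \<phi>) = free_vars \<phi> - {x}"
| "free_vars (Forall x \<phi>) = free_vars \<phi> - {x}"

primrec symbols :: "'p fo \<Rightarrow> 'p set" where
  "symbols (Pos a) = atom_symbols a"
| "symbols (Neg a) = atom_symbols a"
| "symbols (Conj \<phi> \<psi>) = symbols \<phi> \<union> symbols \<psi>"
| "symbols (Disj \<phi> \<psi>) = symbols \<phi> \<union> symbols \<psi>"
| "symbols (Exists x \<phi>) = symbols \<phi>"
| "symbols (Forall x \<phi>) = symbols \<phi>"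

primrec fo_size :: "'p fo \<Rightarrow> nat" where
  "fo_size (Pos a) = 1"
| "fo_size (Neg a) = 1"
| "fo_size (Conj \<phi> \<psi>) = fo_size \<phi> + fo_size \<psi> + 1"
| "fo_size (Disj \<phi> \<psi>) = fo_size \<phi> + fo_size \<psi> + 1"
| "fo_size (Exists x \<phi>) = fo_size \<phi> + 1"
| "fo_size (Forall x \<phi>) = fo_size \<phi> + 1"

primrec sat_atom :: "('p \<Rightarrow> nat set) \<Rightarrow> (nat \<Rightarrow> nat) \<Rightarrow> 'p atom \<Rightarrow> bool" where
  "sat_atom M s (Eq x y) \<longleftrightarrow> s x = s y"
| "sat_atom M s (Rel P x) \<longleftrightarrow> s x \<in> M P"

primrec sat :: "nat \<Rightarrow> ('p \<Rightarrow> nat set) \<Rightarrow> (nat \<Rightarrow> nat) \<Rightarrow> 'p fo \<Rightarrow> bool" where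
  "sat n M s (Pos a) \<longleftrightarrow> sat_atom M s a"
| "sat n M s (Neg a) \<longleftrightarrow> \<not> sat_atom M s a"
| "sat n M s (Conj \<phi> \<psi>) \<longleftrightarrow> sat n M s \<phi> \<and> sat n M s \<psi>"
| "sat n M s (Disj \<phi> \<psi>) \<longleftrightarrow> sat n M s \<phi> \<or> sat n M s \<psi>"
| "sat n M s (Exists x \<phi>) \<longleftrightarrow> (\<exists>d\<in>{1..n}. sat n M (s(x := d)) \<phi>)"
| "sat n M s (Forall x \<phi>) \<longleftrightarrow> (\<forall>d\<in>{1..n}. sat n M (s(x := d)) \<phi>)"

definition is_sentence :: "'p set \<Rightarrow> 'p fo \<Rightarrow> bool" where
  "is_sentence \<tau> \<phi> \<longleftrightarrow> symbols \<phi> \<subseteq> \<tau> \<and> free_vars \<phi> = {}"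

text \<open>
  For sentences the truth value does not depend on the assignment, so the quantification over
  all assignments below is harmless.
\<close>

definition satisfies :: "nat \<Rightarrow> ('p \<Rightarrow> nat set) \<Rightarrow> 'p fo \<Rightarrow> bool" where
  "satisfies n M \<phi> \<longleftrightarrow> (\<forall>s. sat n M s \<phi>)"

definition defines_model :: "'p set \<Rightarrow> nat \<Rightarrow> ('p \<Rightarrow> nat set) \<Rightarrow> 'p fo \<Rightarrow> bool" where
  "defines_model \<tau> n M \<phi> \<longleftrightarrow>
    is_sentence \<tau> \<phi> \<and>
    (\<forall>N. is_model \<tau> n N \<longrightarrow> (satisfies n N \<phi> \<longleftrightarrow> isomorphic_models \<tau> n M N))"

text \<open>
  For finite \<open>\<tau>\<close> a defining sentence always exists (describe the types of \<open>n\<close> pairwise distinct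
  points), so the minimum below is attained.
\<close>

definition description_complexity :: "'p set \<Rightarrow> nat \<Rightarrow> ('p \<Rightarrow> nat set) \<Rightarrow> nat" where
  "description_complexity \<tau> n M = (LEAST k. \<exists>\<phi>. defines_model \<tau> n M \<phi> \<and> fo_size \<phi> = k)"

end

theory Submission imports Defs begin

text \<open>
  A formula with \<open>a\<close> atoms and \<open>q\<close> quantifiers has size \<open>2 * a - 1 + q\<close>. Let \<open>m\<close> be the second
  largest type count and let \<open>N\<close> arise from \<open>M\<close> by moving one point from the second largest to
  the largest type. Type counts of \<open>M\<close> and \<open>N\<close> then agree or are both at least \<open>m - 1\<close>, so the
  Ehrenfeucht--Fraisse argument gives \<open>q \<ge> m\<close>. For \<open>a \<ge> m - 1\<close>, one groups the free
  variables of each subformula into blocks: the truth value only depends on how the assignment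
  behaves on each block separately, and quantifying \<open>x\<close> merges the blocks containing \<open>x\<close>. In the
  Ehrenfeucht--Fraisse argument a new element then only has to be compared with its own block, and
  a block never has more than \<open>a\<close> other variables.
\<close>

section \<open>Matching assignments\<close>

text \<open>Says that sending \<open>s x\<close> to \<open>t x\<close> for \<open>x\<close> in
  \<open>F\<close> is a partial isomorphism from \<open>M\<close> to \<open>N\<close>. Phrased on
  variables, so that repeated values are allowed.\<close>

definition matches ::
    "'p set \<Rightarrow> nat \<Rightarrow> nat set \<Rightarrow> ('p \<Rightarrow> nat set) \<Rightarrow> (nat \<Rightarrow> nat) \<Rightarrow> ('p \<Rightarrow> nat set) \<Rightarrow> (nat \<Rightarrow> nat) \<Rightarrow> bool" where
  "matches \<tau> n F M s N t \<longleftrightarrow>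
    (\<forall>x\<in>F. s x \<in> {1..n} \<and> t x \<in> {1..n} \<and> (\<forall>P\<in>\<tau>. s x \<in> M P \<longleftrightarrow> t x \<in> N P) \<and>
      (\<forall>y\<in>F. s x = s y \<longleftrightarrow> t x = t y))"

text \<open>Type counts are indistinguishable once truncated at \<open>K\<close>; this is what lets
  the duplicator survive as long as fewer than \<open>K\<close> points are compared.\<close>

definition similar_counts ::
    "'p set \<Rightarrow> nat \<Rightarrow> nat \<Rightarrow> ('p \<Rightarrow> nat set) \<Rightarrow> ('p \<Rightarrow> nat set) \<Rightarrow> bool" where
  "similar_counts \<tau> n K M N \<longleftrightarrow>
    (\<forall>\<pi>\<subseteq>\<tau>. type_count \<tau> n M \<pi> = type_count \<tau> n N \<pi> \<or>
      K \<le> type_count \<tau> n M \<pi> \<and> K \<le> type_count \<tau> n N \<pi>)"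

lemma matches_sym: "matches \<tau> n F M s N t \<Longrightarrow> matches \<tau> n F N t M s"
  by (simp add: matches_def)

lemma matches_mono: "matches \<tau> n F M s N t \<Longrightarrow> G \<subseteq> F \<Longrightarrow> matches \<tau> n G M s N t"
  unfolding matches_def by blast

lemma matches_empty: "matches \<tau> n {} M s N t"
  by (simp add: matches_def)

lemma matches_upd_notin:
  "x \<notin> F \<Longrightarrow> matches \<tau> n F M (s(x := d)) N (t(x := e)) \<longleftrightarrow> matches \<tau> n F M s N t"
  unfolding matches_def by (intro ball_cong) auto

lemma similar_counts_sym: "similar_counts \<tau> n K M N \<Longrightarrow> similar_counts \<tau> n K N M"
  unfolding similar_counts_def by metis

text \<open>On \<open>F\<close> the map \<open>t\<close> factors through \<open>s\<close>, with
  \<open>t \<circ> inv_into F s\<close> as the second factor.\<close>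

lemma card_image_le_same_kernel:
  assumes "finite F" "\<And>x y. x \<in> F \<Longrightarrow> y \<in> F \<Longrightarrow> s x = s y \<Longrightarrow> t x = t y"
  shows "card (t ` F) \<le> card (s ` F)"
proof -
  have "t x = t (inv_into F s (s x))" if "x \<in> F" for x
    using assms(2)[of x "inv_into F s (s x)"] that
    by (metis f_inv_into_f image_eqI inv_into_into)
  then have "t ` F \<subseteq> (t \<circ> inv_into F s) ` (s ` F)" by fastforce
  then show ?thesis using assms(1) by (meson finite_imageI surj_card_le)
qed

lemma finite_type_points: "finite (type_points \<tau> n M \<pi>)"
  unfolding type_points_def by simp

text \<open>One round of the Ehrenfeucht--Fraisse game. An element already named by some variable
  has a forced answer. A new one is answered by an unnamed point of the same type, which exists
  because fewer than \<open>K\<close> variables are in play.\<close>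

lemma matches_extend:
  assumes sim: "similar_counts \<tau> n K M N" and fin: "finite F" and small: "card F < K"
    and m: "matches \<tau> n F M s N t" and d: "d \<in> {1..n}" and x: "x \<notin> F"
  obtains e where "e \<in> {1..n}" "matches \<tau> n (insert x F) M (s(x := d)) N (t(x := e))"
proof (cases "d \<in> s ` F")
  case True
  then obtain y where y: "y \<in> F" "d = s y" by blast
  have "matches \<tau> n (insert x F) M (s(x := d)) N (t(x := t y))"
    using m y x unfolding matches_def by auto
  moreover have "t y \<in> {1..n}" using m y unfolding matches_def by blast
  ultimately show ?thesis using that by blast
next
  case False
  define p where "p = {P \<in> \<tau>. d \<in> M P}"
  \<comment> \<open>The variables naming points of the type \<open>p\<close> of \<open>d\<close>;
    matching makes them the same variables on both sides.\<close>
  define F' where "F' = {y \<in> F. s y \<in> type_points \<tau> n M p}"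
  have F'2: "y \<in> F' \<longleftrightarrow> t y \<in> type_points \<tau> n N p" if "y \<in> F" for y
    using m that unfolding matches_def F'_def type_points_def by auto
  have finF': "finite F'" using fin unfolding F'_def by auto
  have dT: "d \<in> type_points \<tau> n M p" using d unfolding type_points_def p_def by auto
  have "\<exists>e. e \<in> type_points \<tau> n N p \<and> e \<notin> t ` F"
  proof (rule ccontr)
    assume "\<not> ?thesis"
    then have "type_points \<tau> n N p \<subseteq> t ` F'" using F'2 by blast
    then have cN: "type_count \<tau> n N p \<le> card (t ` F')"
      unfolding type_count_def using finF' by (simp add: card_mono)
    have le: "card (t ` F') \<le> card F"
      using card_image_le[OF finF', of t] card_mono[OF fin, of F'] unfolding F'_def
      by fastforce
    \<comment> \<open>If every point of type \<open>p\<close> in \<open>N\<close> is named, then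
      \<open>M\<close> has strictly more points of that type: as many named ones, and the unnamed
      \<open>d\<close>. Different counts force at least \<open>K\<close> points in \<open>N\<close>,
      more than \<open>F\<close> can name.\<close>
    have "card (t ` F') \<le> card (s ` F')"
      using m finF' by (intro card_image_le_same_kernel) (auto simp: matches_def F'_def)
    also have "\<dots> < type_count \<tau> n M p"
      unfolding type_count_def
      by (rule psubset_card_mono[OF finite_type_points]) (use dT False in \<open>auto simp: F'_def\<close>)
    finally have "type_count \<tau> n M p \<noteq> type_count \<tau> n N p" using cN by simp
    moreover have "p \<subseteq> \<tau>" unfolding p_def by auto
    ultimately have "K \<le> type_count \<tau> n N p"
      using sim unfolding similar_counts_def by blast
    then show False using cN le small by simp
  qed
  then obtain e where e: "e \<in> type_points \<tau> n N p" "e \<notin> t ` F" by blast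
  have "matches \<tau> n (insert x F) M (s(x := d)) N (t(x := e))"
    unfolding matches_def
  proof (intro ballI conjI)
    fix y z P assume "y \<in> insert x F" "z \<in> insert x F"
    then show "((s(x := d)) y = (s(x := d)) z) = ((t(x := e)) y = (t(x := e)) z)"
      using m False e(2) x unfolding matches_def by auto
  qed (use m d e in \<open>auto simp: matches_def type_points_def p_def\<close>)
  then show ?thesis using e(1) that unfolding type_points_def by blast
qed

text \<open>The quantifier step shared by both congruence proofs; \<open>R\<close> is the relation
  between a move and its answer.\<close>

lemma back_and_forth_quantifiers:
  assumes "\<And>d. d \<in> D \<Longrightarrow> \<exists>e\<in>D. R d e" "\<And>e. e \<in> D \<Longrightarrow> \<exists>d\<in>D. R d e"
    and "\<And>d e. R d e \<Longrightarrow> A d \<longleftrightarrow> B e"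
  shows "(\<exists>d\<in>D. A d) \<longleftrightarrow> (\<exists>e\<in>D. B e)" "(\<forall>d\<in>D. A d) \<longleftrightarrow> (\<forall>e\<in>D. B e)"
  using assms by blast+

lemma sat_atom_cong:
  assumes "matches \<tau> n F M s N t" "atom_vars a \<subseteq> F" "atom_symbols a \<subseteq> \<tau>"
  shows "sat_atom M s a \<longleftrightarrow> sat_atom N t a"
  using assms by (cases a) (auto simp: matches_def)

section \<open>Counting quantifiers\<close>

primrec atom_count :: "'p fo \<Rightarrow> nat" where
  "atom_count (Pos a) = 1"
| "atom_count (Neg a) = 1"
| "atom_count (Conj \<phi> \<psi>) = atom_count \<phi> + atom_count \<psi>"
| "atom_count (Disj \<phi> \<psi>) = atom_count \<phi> + atom_count \<psi>"
| "atom_count (Exists x \<phi>) = atom_count \<phi>"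
| "atom_count (Forall x \<phi>) = atom_count \<phi>"

primrec quantifier_count :: "'p fo \<Rightarrow> nat" where
  "quantifier_count (Pos a) = 0"
| "quantifier_count (Neg a) = 0"
| "quantifier_count (Conj \<phi> \<psi>) = quantifier_count \<phi> + quantifier_count \<psi>"
| "quantifier_count (Disj \<phi> \<psi>) = quantifier_count \<phi> + quantifier_count \<psi>"
| "quantifier_count (Exists x \<phi>) = quantifier_count \<phi> + 1"
| "quantifier_count (Forall x \<phi>) = quantifier_count \<phi> + 1"

text \<open>The syntax tree has one binary connective fewer than atoms. The \<open>+ 1\<close> on
  the left avoids truncated subtraction.\<close>

lemma fo_size_eq: "fo_size \<phi> + 1 = 2 * atom_count \<phi> + quantifier_count \<phi>"
  by (induction \<phi>) auto

lemma matches_extend_Diff: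
  assumes "similar_counts \<tau> n K M N" "finite V" "card V < K"
    and "matches \<tau> n V M s N t" "d \<in> {1..n}"
  shows "\<exists>e\<in>{1..n}. matches \<tau> n (insert x V) M (s(x := d)) N (t(x := e))"
proof -
  \<comment> \<open>A requantified variable first loses its old value, so the move is answered
    against \<open>V - {x}\<close>.\<close>
  have "card (V - {x}) < K" using assms(2,3) by (meson card_Diff1_le le_less_trans)
  moreover have "matches \<tau> n (V - {x}) M s N t" using assms(4) by (rule matches_mono) blast
  ultimately obtain e where "e \<in> {1..n}"
    "matches \<tau> n (insert x (V - {x})) M (s(x := d)) N (t(x := e))"
    using matches_extend[of \<tau> n K M N "V - {x}" s t d x] assms(1,2,5) by blast
  then show ?thesis by auto
qed

text \<open>The sum \<open>card V + quantifier_count \<phi>\<close> is a budget: passing a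
  quantifier adds at most one variable to \<open>V\<close> and uses up one quantifier. At a
  quantifier it gives \<open>card V < K\<close>, so the move can be answered.\<close>

lemma sat_cong_quantifier_count:
  assumes "similar_counts \<tau> n K M N" "finite V" "free_vars \<phi> \<subseteq> V" "symbols \<phi> \<subseteq> \<tau>"
    and "card V + quantifier_count \<phi> \<le> K" "matches \<tau> n V M s N t"
  shows "sat n M s \<phi> \<longleftrightarrow> sat n N t \<phi>"
  using assms(2-)
proof (induction \<phi> arbitrary: V s t)
  case (Pos a)
  then show ?case using sat_atom_cong by fastforce
next
  case (Neg a)
  then show ?case using sat_atom_cong by fastforce
next
  case (Conj \<phi> \<psi>)
  have "sat n M s \<phi> = sat n N t \<phi>" by (rule Conj.IH(1)[of V]) (use Conj.prems in auto)
  moreover have "sat n M s \<psi> = sat n N t \<psi>" by (rule Conj.IH(2)[of V]) (use Conj.prems in auto)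
  ultimately show ?case by simp
next
  case (Disj \<phi> \<psi>)
  have "sat n M s \<phi> = sat n N t \<phi>" by (rule Disj.IH(1)[of V]) (use Disj.prems in auto)
  moreover have "sat n M s \<psi> = sat n N t \<psi>" by (rule Disj.IH(2)[of V]) (use Disj.prems in auto)
  ultimately show ?case by simp
next
  case (Exists x \<phi>)
  have IH: "sat n M (s(x := d)) \<phi> \<longleftrightarrow> sat n N (t(x := e)) \<phi>"
    if "matches \<tau> n (insert x V) M (s(x := d)) N (t(x := e))" for d e
    by (rule Exists.IH[OF _ _ _ _ that]) (use Exists.prems in \<open>auto simp: card_insert_if\<close>)
  have small: "card V < K" using Exists.prems by auto
  have forward: "\<exists>e\<in>{1..n}. matches \<tau> n (insert x V) M (s(x := d)) N (t(x := e))" if "d \<in> {1..n}" for d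
    by (rule matches_extend_Diff[OF assms(1) Exists.prems(1) small Exists.prems(5) that])
  have backward: "\<exists>d\<in>{1..n}. matches \<tau> n (insert x V) M (s(x := d)) N (t(x := e))" if "e \<in> {1..n}" for e
    using matches_extend_Diff[OF similar_counts_sym[OF assms(1)] Exists.prems(1) small
        matches_sym[OF Exists.prems(5)] that] matches_sym by blast
  show ?case unfolding sat.simps by (rule back_and_forth_quantifiers(1)[OF forward backward IH])
next
  case (Forall x \<phi>)
  have IH: "sat n M (s(x := d)) \<phi> \<longleftrightarrow> sat n N (t(x := e)) \<phi>"
    if "matches \<tau> n (insert x V) M (s(x := d)) N (t(x := e))" for d e
    by (rule Forall.IH[OF _ _ _ _ that]) (use Forall.prems in \<open>auto simp: card_insert_if\<close>)
  have small: "card V < K" using Forall.prems by auto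
  have forward: "\<exists>e\<in>{1..n}. matches \<tau> n (insert x V) M (s(x := d)) N (t(x := e))" if "d \<in> {1..n}" for d
    by (rule matches_extend_Diff[OF assms(1) Forall.prems(1) small Forall.prems(5) that])
  have backward: "\<exists>d\<in>{1..n}. matches \<tau> n (insert x V) M (s(x := d)) N (t(x := e))" if "e \<in> {1..n}" for e
    using matches_extend_Diff[OF similar_counts_sym[OF assms(1)] Forall.prems(1) small
        matches_sym[OF Forall.prems(5)] that] matches_sym by blast
  show ?case unfolding sat.simps by (rule back_and_forth_quantifiers(2)[OF forward backward IH])
qed

section \<open>Counting atoms\<close>

text \<open>A value for \<open>x\<close> must be answered consistently with every block containing
  \<open>x\<close>, so these blocks are united before \<open>x\<close> is dropped. If no block
  contains \<open>x\<close>, an empty block is added, which constrains nothing.\<close>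

definition merge_blocks :: "nat \<Rightarrow> nat set list \<Rightarrow> nat set list" where
  "merge_blocks x L = (\<Union>(set (filter ((\<in>) x) L)) - {x}) # filter ((\<notin>) x) L"

text \<open>Variables in no common block are never compared by the formula, even through quantified
  intermediaries. Blocks may overlap; a list keeps repeated blocks, so that weights add up over
  connectives.\<close>

primrec blocks :: "'p fo \<Rightarrow> nat set list" where
  "blocks (Pos a) = [atom_vars a]"
| "blocks (Neg a) = [atom_vars a]"
| "blocks (Conj \<phi> \<psi>) = blocks \<phi> @ blocks \<psi>"
| "blocks (Disj \<phi> \<psi>) = blocks \<phi> @ blocks \<psi>"
| "blocks (Exists x \<phi>) = merge_blocks x (blocks \<phi>)"
| "blocks (Forall x \<phi>) = merge_blocks x (blocks \<phi>)"

lemma Union_merge_blocks: "\<Union>(set (merge_blocks x L)) = \<Union>(set L) - {x}"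
  unfolding merge_blocks_def by auto

lemma Union_blocks: "\<Union>(set (blocks \<phi>)) = free_vars \<phi>"
  by (induction \<phi>) (auto simp: Union_merge_blocks)

lemma finite_atom_vars: "finite (atom_vars a)"
  by (cases a) auto

lemma finite_free_vars: "finite (free_vars \<phi>)"
  by (induction \<phi>) (auto simp: finite_atom_vars)

lemma finite_blocks: "F \<in> set (blocks \<phi>) \<Longrightarrow> finite F"
  using Union_blocks finite_free_vars by (metis Union_upper finite_subset)

text \<open>Each united block contains \<open>x\<close>, so it contributes at most
  \<open>card F - 1\<close> other variables; the rest is the union bound.\<close>

lemma card_merged_block:
  assumes "\<forall>F\<in>set L. finite F"
  shows "card (\<Union>(set (filter ((\<in>) x) L)) - {x}) \<le> (\<Sum>F\<leftarrow>filter ((\<in>) x) L. card F - 1)"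
  using assms
proof (induction L)
  case (Cons G L)
  show ?case
  proof (cases "x \<in> G")
    case True
    have "card (\<Union>(set (filter ((\<in>) x) (G # L))) - {x})
        = card ((G - {x}) \<union> (\<Union>(set (filter ((\<in>) x) L)) - {x}))"
      using True by (intro arg_cong[of _ _ card]) auto
    also have "\<dots> \<le> card (G - {x}) + card (\<Union>(set (filter ((\<in>) x) L)) - {x})"
      by (rule card_Un_le)
    also have "\<dots> \<le> (card G - 1) + (\<Sum>F\<leftarrow>filter ((\<in>) x) L. card F - 1)"
      using Cons True by (intro add_mono) auto
    finally show ?thesis using True by simp
  qed (use Cons in auto)
qed simp

lemma sum_list_filter_split:
  fixes f :: "'a \<Rightarrow> nat"
  shows "(\<Sum>x\<leftarrow>filter P L. f x) + (\<Sum>x\<leftarrow>filter (\<lambda>x. \<not> P x) L. f x) = (\<Sum>x\<leftarrow>L. f x)"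
  by (induction L) auto

text \<open>Even the cardinality of the merged block, not just that minus one, is at most the total
  weight of its parts.\<close>

lemma weight_merge_blocks:
  assumes "\<forall>F\<in>set L. finite F"
  shows "(\<Sum>F\<leftarrow>merge_blocks x L. card F - 1) \<le> (\<Sum>F\<leftarrow>L. card F - 1)"
  using card_merged_block[OF assms, of x]
    sum_list_filter_split[of "\<lambda>F. card F - 1" "(\<in>) x" L]
  unfolding merge_blocks_def by simp

lemma card_atom_vars: "card (atom_vars a) \<le> 2"
  by (cases a) (auto simp: card_insert_if)

text \<open>An atom has at most two variables and so weight at most one; connectives add weights and
  quantifiers do not increase them. Truncated subtraction gives empty blocks weight zero.\<close>

lemma weight_blocks: "(\<Sum>F\<leftarrow>blocks \<phi>. card F - 1) \<le> atom_count \<phi>"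
proof (induction \<phi>)
  case (Pos a)
  then show ?case using card_atom_vars[of a] by simp
next
  case (Neg a)
  then show ?case using card_atom_vars[of a] by simp
next
  case (Exists x \<phi>)
  then show ?case using weight_merge_blocks[of "blocks \<phi>" x] finite_blocks by fastforce
next
  case (Forall x \<phi>)
  then show ?case using weight_merge_blocks[of "blocks \<phi>" x] finite_blocks by fastforce
qed auto

text \<open>The answer to \<open>d\<close> has to respect only the merged block of \<open>x\<close>,
  whose size is bounded by the number of atoms, however many variables are free.\<close>

lemma blocks_extend:
  assumes sim: "similar_counts \<tau> n K M N" and small: "atom_count \<phi> < K" and d: "d \<in> {1..n}"
    and m: "\<forall>F\<in>set (merge_blocks x (blocks \<phi>)). matches \<tau> n F M s N t"
  shows "\<exists>e\<in>{1..n}. \<forall>F\<in>set (blocks \<phi>). matches \<tau> n F M (s(x := d)) N (t(x := e))"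
proof -
  define G where "G = \<Union>(set (filter ((\<in>) x) (blocks \<phi>))) - {x}"
  have fin: "\<forall>F\<in>set (blocks \<phi>). finite F" using finite_blocks by blast
  have "card G \<le> (\<Sum>F\<leftarrow>filter ((\<in>) x) (blocks \<phi>). card F - 1)"
    unfolding G_def by (rule card_merged_block[OF fin])
  also have "\<dots> \<le> (\<Sum>F\<leftarrow>blocks \<phi>. card F - 1)"
    using sum_list_filter_split[of "\<lambda>F. card F - 1" "(\<in>) x" "blocks \<phi>"] by linarith
  also have "\<dots> < K" using weight_blocks[of \<phi>] small by simp
  finally have "card G < K" .
  moreover have "finite G" unfolding G_def using fin by auto
  moreover have "matches \<tau> n G M s N t" using m unfolding G_def merge_blocks_def by simp
  moreover have "x \<notin> G" unfolding G_def by simp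
  ultimately obtain e where e: "e \<in> {1..n}"
    "matches \<tau> n (insert x G) M (s(x := d)) N (t(x := e))"
    using matches_extend[OF sim _ _ _ d] by metis
  \<comment> \<open>A block containing \<open>x\<close> lies inside \<open>insert x G\<close>; any
    other block survives the merge and does not see the update.\<close>
  have "matches \<tau> n F M (s(x := d)) N (t(x := e))" if F: "F \<in> set (blocks \<phi>)" for F
  proof (cases "x \<in> F")
    case True
    with F have "F \<subseteq> insert x G" unfolding G_def by auto
    then show ?thesis using e(2) matches_mono by blast
  next
    case False
    with F m show ?thesis by (simp add: matches_upd_notin merge_blocks_def)
  qed
  then show ?thesis using e(1) by blast
qed

text \<open>The invariant is matching on each block separately. Quantifiers leave
  \<open>atom_count\<close> unchanged, so the bound is not consumed along the induction.\<close>

lemma sat_cong_atom_count: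
  assumes "similar_counts \<tau> n K M N" "symbols \<phi> \<subseteq> \<tau>" "atom_count \<phi> < K"
    and "\<forall>F\<in>set (blocks \<phi>). matches \<tau> n F M s N t"
  shows "sat n M s \<phi> \<longleftrightarrow> sat n N t \<phi>"
  using assms(2-)
proof (induction \<phi> arbitrary: s t)
  case (Pos a)
  then show ?case using sat_atom_cong by fastforce
next
  case (Neg a)
  then show ?case using sat_atom_cong by fastforce
next
  case (Conj \<phi> \<psi>)
  have "sat n M s \<phi> = sat n N t \<phi>" by (rule Conj.IH(1)) (use Conj.prems in auto)
  moreover have "sat n M s \<psi> = sat n N t \<psi>" by (rule Conj.IH(2)) (use Conj.prems in auto)
  ultimately show ?case by simp
next
  case (Disj \<phi> \<psi>)
  have "sat n M s \<phi> = sat n N t \<phi>" by (rule Disj.IH(1)) (use Disj.prems in auto)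
  moreover have "sat n M s \<psi> = sat n N t \<psi>" by (rule Disj.IH(2)) (use Disj.prems in auto)
  ultimately show ?case by simp
next
  case (Exists x \<phi>)
  have IH: "sat n M (s(x := d)) \<phi> \<longleftrightarrow> sat n N (t(x := e)) \<phi>"
    if "\<forall>F\<in>set (blocks \<phi>). matches \<tau> n F M (s(x := d)) N (t(x := e))" for d e
    by (rule Exists.IH[OF _ _ that]) (use Exists.prems in auto)
  have small: "atom_count \<phi> < K"
    and m: "\<forall>F\<in>set (merge_blocks x (blocks \<phi>)). matches \<tau> n F M s N t"
    using Exists.prems by auto
  then have m': "\<forall>F\<in>set (merge_blocks x (blocks \<phi>)). matches \<tau> n F N t M s"
    using matches_sym by blast
  have forward: "\<exists>e\<in>{1..n}. \<forall>F\<in>set (blocks \<phi>). matches \<tau> n F M (s(x := d)) N (t(x := e))" if "d \<in> {1..n}" for d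
    by (rule blocks_extend[OF assms(1) small that m])
  have backward: "\<exists>d\<in>{1..n}. \<forall>F\<in>set (blocks \<phi>). matches \<tau> n F M (s(x := d)) N (t(x := e))" if "e \<in> {1..n}" for e
    using blocks_extend[OF similar_counts_sym[OF assms(1)] small that m'] matches_sym by blast
  show ?case unfolding sat.simps by (rule back_and_forth_quantifiers(1)[OF forward backward IH])
next
  case (Forall x \<phi>)
  have IH: "sat n M (s(x := d)) \<phi> \<longleftrightarrow> sat n N (t(x := e)) \<phi>"
    if "\<forall>F\<in>set (blocks \<phi>). matches \<tau> n F M (s(x := d)) N (t(x := e))" for d e
    by (rule Forall.IH[OF _ _ that]) (use Forall.prems in auto)
  have small: "atom_count \<phi> < K"
    and m: "\<forall>F\<in>set (merge_blocks x (blocks \<phi>)). matches \<tau> n F M s N t"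
    using Forall.prems by auto
  then have m': "\<forall>F\<in>set (merge_blocks x (blocks \<phi>)). matches \<tau> n F N t M s"
    using matches_sym by blast
  have forward: "\<exists>e\<in>{1..n}. \<forall>F\<in>set (blocks \<phi>). matches \<tau> n F M (s(x := d)) N (t(x := e))" if "d \<in> {1..n}" for d
    by (rule blocks_extend[OF assms(1) small that m])
  have backward: "\<exists>d\<in>{1..n}. \<forall>F\<in>set (blocks \<phi>). matches \<tau> n F M (s(x := d)) N (t(x := e))" if "e \<in> {1..n}" for e
    using blocks_extend[OF similar_counts_sym[OF assms(1)] small that m'] matches_sym by blast
  show ?case unfolding sat.simps by (rule back_and_forth_quantifiers(2)[OF forward backward IH])
qed

text \<open>With \<open>a \<ge> K\<close> atoms and \<open>q \<ge> K + 1\<close> quantifiers, the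
  size \<open>2 * a + q - 1\<close> is at least \<open>3 * K\<close>.\<close>

lemma fo_size_distinguishing:
  assumes sim: "similar_counts \<tau> n K M N" and sen: "is_sentence \<tau> \<phi>"
    and dist: "satisfies n M \<phi> \<noteq> satisfies n N \<phi>"
  shows "3 * K \<le> fo_size \<phi>"
proof -
  have sym: "symbols \<phi> \<subseteq> \<tau>" and closed: "free_vars \<phi> = {}"
    using sen unfolding is_sentence_def by auto
  obtain s where s: "sat n M s \<phi> \<noteq> sat n N s \<phi>"
    using dist unfolding satisfies_def by blast
  \<comment> \<open>The blocks of a sentence are all empty, so matching is vacuous.\<close>
  have "\<forall>F\<in>set (blocks \<phi>). matches \<tau> n F M s N s"
    using Union_blocks[of \<phi>] closed matches_empty by fastforce
  then have "K \<le> atom_count \<phi>"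
    using sat_cong_atom_count[OF sim sym] s by (meson not_le)
  \<comment> \<open>Starting from no variables, the budget tolerates exactly \<open>K\<close>
    quantifiers. The strictness here makes up for the \<open>- 1\<close> in the size
    formula.\<close>
  moreover have "K < quantifier_count \<phi>"
    using sat_cong_quantifier_count[OF sim, of "{}" \<phi> s s] closed sym matches_empty s
    by (metis add_0 card.empty finite.emptyI not_le subset_refl)
  ultimately show ?thesis using fo_size_eq[of \<phi>] by linarith
qed

section \<open>Existence of a defining sentence\<close>

lemma sat_foldr_Conj:
  "sat n N s (foldr Conj \<phi>s \<psi>) \<longleftrightarrow> (\<forall>\<phi>\<in>set \<phi>s. sat n N s \<phi>) \<and> sat n N s \<psi>"
  by (induction \<phi>s) auto

lemma free_vars_foldr_Conj:
  "free_vars (foldr Conj \<phi>s \<psi>) = (\<Union>\<phi>\<in>set \<phi>s. free_vars \<phi>) \<union> free_vars \<psi>"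
  by (induction \<phi>s) auto

lemma symbols_foldr_Conj:
  "symbols (foldr Conj \<phi>s \<psi>) = (\<Union>\<phi>\<in>set \<phi>s. symbols \<phi>) \<union> symbols \<psi>"
  by (induction \<phi>s) auto

lemma sat_foldr_Exists:
  "sat n N s (foldr Exists xs \<phi>) \<longleftrightarrow>
    (\<exists>t. (\<forall>i\<in>set xs. t i \<in> {1..n}) \<and> (\<forall>i. i \<notin> set xs \<longrightarrow> t i = s i) \<and> sat n N t \<phi>)"
proof (induction xs arbitrary: s)
  case Nil
  have "t = s" if "\<forall>i. t i = s i" for t using that by blast
  then show ?case by auto
next
  case (Cons x xs)
  show ?case (is "?L \<longleftrightarrow> ?R")
  proof
    assume ?L
    then obtain d t where "d \<in> {1..n}" "\<forall>i\<in>set xs. t i \<in> {1..n}"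
      "\<forall>i. i \<notin> set xs \<longrightarrow> t i = (s(x := d)) i" "sat n N t \<phi>"
      using Cons by auto
    then have "(\<forall>i\<in>set (x # xs). t i \<in> {1..n}) \<and>
      (\<forall>i. i \<notin> set (x # xs) \<longrightarrow> t i = s i) \<and> sat n N t \<phi>"
      by (auto; metis)
    then show ?R by blast
  next
    assume ?R
    then obtain t where "\<forall>i\<in>set (x # xs). t i \<in> {1..n}"
      "\<forall>i. i \<notin> set (x # xs) \<longrightarrow> t i = s i" "sat n N t \<phi>" by blast
    then have "t x \<in> {1..n} \<and> sat n N (s(x := t x)) (foldr Exists xs \<phi>)"
      unfolding Cons.IH by (intro conjI exI[of _ t]) simp_all
    then show ?L by auto
  qed
qed

lemma free_vars_foldr_Exists: "free_vars (foldr Exists xs \<phi>) = free_vars \<phi> - set xs"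
  by (induction xs) auto

lemma symbols_foldr_Exists: "symbols (foldr Exists xs \<phi>) = symbols \<phi>"
  by (induction xs) auto

text \<open>Guarantees that the \<open>LEAST\<close> in \<open>description_complexity\<close> is
  attained. The sentence lets variable \<open>i\<close> stand for the image of point
  \<open>i\<close> and describes an injective map preserving all symbols of \<open>\<tau>\<close>
  both ways.\<close>

lemma defining_sentence_exists:
  fixes \<tau> :: "'p set"
  assumes "finite \<tau>" "n \<ge> 1"
  shows "\<exists>\<phi>. defines_model \<tau> n M \<phi>"
proof -
  define D where "D = (\<lambda>(i, j). Neg (Eq i j) :: 'p fo) ` {(i, j). i \<in> {1..n} \<and> j \<in> {1..n} \<and> i \<noteq> j}"
  define R where "R = (\<lambda>(P, i). if i \<in> M P then Pos (Rel P i) else Neg (Rel P i)) ` (\<tau> \<times> {1..n})"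
  have "finite {(i::nat, j). i \<in> {1..n} \<and> j \<in> {1..n} \<and> i \<noteq> j}"
    by (rule finite_subset[of _ "{1..n} \<times> {1..n}"]) auto
  then have "finite (D \<union> R)" unfolding D_def R_def using assms(1) by blast
  then obtain \<phi>s where \<phi>s: "set \<phi>s = D \<union> R" using finite_list by blast
  \<comment> \<open>The seed of the conjunction is trivially true; since \<open>n \<ge> 1\<close>,
    its variable is among the quantified ones.\<close>
  define \<psi> where "\<psi> = foldr Conj \<phi>s (Pos (Eq 1 1))"
  define \<chi> where "\<chi> = foldr Exists [1..<Suc n] \<psi>"
  have range: "set [1..<Suc n] = {1..n}" by auto
  have "(\<forall>\<phi>\<in>D. sat n N t \<phi>) \<longleftrightarrow> (\<forall>i\<in>{1..n}. \<forall>j\<in>{1..n}. i \<noteq> j \<longrightarrow> t i \<noteq> t j)" for N t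
    unfolding D_def by auto
  then have "(\<forall>\<phi>\<in>D. sat n N t \<phi>) \<longleftrightarrow> inj_on t {1..n}" for N t
    unfolding inj_on_def by metis
  moreover have "(\<forall>\<phi>\<in>R. sat n N t \<phi>) \<longleftrightarrow> (\<forall>P\<in>\<tau>. \<forall>i\<in>{1..n}. i \<in> M P \<longleftrightarrow> t i \<in> N P)" for N t
    unfolding R_def by (auto split: if_splits)
  ultimately have sat_\<psi>: "sat n N t \<psi> \<longleftrightarrow>
      inj_on t {1..n} \<and> (\<forall>P\<in>\<tau>. \<forall>i\<in>{1..n}. i \<in> M P \<longleftrightarrow> t i \<in> N P)" for N t
    unfolding \<psi>_def sat_foldr_Conj \<phi>s by (simp add: ball_Un)
  have "sat n N s \<chi> \<longleftrightarrow> isomorphic_models \<tau> n M N" for N s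
  proof
    assume "sat n N s \<chi>"
    then obtain t where t: "\<forall>i\<in>{1..n}. t i \<in> {1..n}" "sat n N t \<psi>"
      unfolding \<chi>_def sat_foldr_Exists range by blast
    then have "inj_on t {1..n}" "t ` {1..n} \<subseteq> {1..n}" unfolding sat_\<psi> by blast+
    \<comment> \<open>An injective self-map of a finite set is onto, so the sentence need not
      express surjectivity.\<close>
    then have "bij_betw t {1..n} {1..n}"
      unfolding bij_betw_def using endo_inj_surj by blast
    then show "isomorphic_models \<tau> n M N"
      using t sat_\<psi> unfolding isomorphic_models_def by blast
  next
    assume "isomorphic_models \<tau> n M N"
    then obtain f where f: "bij_betw f {1..n} {1..n}"
      "\<forall>P\<in>\<tau>. \<forall>x\<in>{1..n}. x \<in> M P \<longleftrightarrow> f x \<in> N P"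
      unfolding isomorphic_models_def by blast
    let ?t = "\<lambda>i. if i \<in> {1..n} then f i else s i"
    have "inj_on ?t {1..n}"
      using bij_betw_imp_inj_on[OF f(1)] by (subst inj_on_cong[of _ _ f]) auto
    then have "sat n N ?t \<psi>" using f(2) unfolding sat_\<psi> by auto
    moreover have "\<forall>i\<in>{1..n}. ?t i \<in> {1..n}" using bij_betw_apply[OF f(1)] by metis
    moreover have "\<forall>i. i \<notin> {1..n} \<longrightarrow> ?t i = s i" by simp
    ultimately show "sat n N s \<chi>"
      unfolding \<chi>_def sat_foldr_Exists range by (intro exI[of _ ?t] conjI)
  qed
  moreover have "is_sentence \<tau> \<chi>"
    using assms(2)
    unfolding is_sentence_def \<chi>_def \<psi>_def free_vars_foldr_Exists range symbols_foldr_Exists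
      free_vars_foldr_Conj symbols_foldr_Conj \<phi>s D_def R_def
    by (auto split: if_splits)
  ultimately show ?thesis unfolding defines_model_def satisfies_def by blast
qed

section \<open>Moving a point to another type\<close>

text \<open>An isomorphism restricts to a bijection between the points of each type.\<close>

lemma isomorphic_models_type_count:
  assumes "isomorphic_models \<tau> n M N"
  shows "type_count \<tau> n M \<pi> = type_count \<tau> n N \<pi>"
proof -
  obtain f where f: "bij_betw f {1..n} {1..n}"
      "\<forall>P\<in>\<tau>. \<forall>x\<in>{1..n}. x \<in> M P \<longleftrightarrow> f x \<in> N P"
    using assms unfolding isomorphic_models_def by blast
  have inj: "inj_on f (type_points \<tau> n M \<pi>)"
    using f(1) unfolding bij_betw_def type_points_def by (auto intro: inj_on_subset)
  have "f ` type_points \<tau> n M \<pi> = type_points \<tau> n N \<pi>"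
  proof (intro equalityI subsetI)
    fix y assume y: "y \<in> type_points \<tau> n N \<pi>"
    then have "y \<in> f ` {1..n}" using f(1) unfolding bij_betw_def type_points_def by auto
    then obtain x where "x \<in> {1..n}" "y = f x" by blast
    then show "y \<in> f ` type_points \<tau> n M \<pi>" using y f(2) unfolding type_points_def by auto
  next
    fix y assume "y \<in> f ` type_points \<tau> n M \<pi>"
    then show "y \<in> type_points \<tau> n N \<pi>"
      using f bij_betw_apply[OF f(1)] unfolding type_points_def by auto
  qed
  then show ?thesis using card_image[OF inj] unfolding type_count_def by simp
qed

definition move_point :: "nat \<Rightarrow> 'p set \<Rightarrow> ('p \<Rightarrow> nat set) \<Rightarrow> 'p \<Rightarrow> nat set" where
  "move_point x \<pi> M P = (if P \<in> \<pi> then insert x (M P) else M P - {x})"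

lemma type_points_move_point:
  assumes "x \<in> {1..n}" "\<pi> \<subseteq> \<tau>" "\<rho> \<subseteq> \<tau>"
  shows "type_points \<tau> n (move_point x \<pi> M) \<rho> =
    (if \<rho> = \<pi> then insert x (type_points \<tau> n M \<rho>) else type_points \<tau> n M \<rho> - {x})"
proof -
  have "(y \<in> move_point x \<pi> M P) = (if y = x then P \<in> \<pi> else y \<in> M P)" for y P
    unfolding move_point_def by auto
  \<comment> \<open>Hence the moved point has type \<open>\<pi>\<close> and no other.\<close>
  moreover have "(\<forall>P\<in>\<tau>. P \<in> \<pi> \<longleftrightarrow> P \<in> \<rho>) \<longleftrightarrow> \<rho> = \<pi>" using assms by blast
  ultimately show ?thesis using assms(1) unfolding type_points_def by auto
qed

theorem theorem4:
  fixes \<tau> :: "'p set" and n :: nat and M :: "'p \<Rightarrow> nat set"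
    and l :: nat and \<pi> :: "nat \<Rightarrow> 'p set"
  assumes "finite \<tau>"
    and "is_model \<tau> n M"
    and "l \<ge> 2"
    and "bij_betw \<pi> {1..l} (realized_types \<tau> n M)"
    and "\<And>i j. 1 \<le> i \<Longrightarrow> i \<le> j \<Longrightarrow> j \<le> l \<Longrightarrow>
           type_count \<tau> n M (\<pi> i) \<le> type_count \<tau> n M (\<pi> j)"
  shows "int (description_complexity \<tau> n M) \<ge> 3 * int (type_count \<tau> n M (\<pi> (l - 1))) - 3"
proof -
  define p q where "p = \<pi> (l - 1)" and "q = \<pi> l"
  have idx: "l - 1 \<in> {1..l}" "l \<in> {1..l}" "l - 1 \<noteq> l" using assms(3) by auto
  then have pq: "p \<in> realized_types \<tau> n M" "q \<in> realized_types \<tau> n M" "p \<noteq> q"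
    using bij_betw_apply[OF assms(4)] inj_onD[OF bij_betw_imp_inj_on[OF assms(4)]]
    unfolding p_def q_def by blast+
  then have sub: "p \<subseteq> \<tau>" "q \<subseteq> \<tau>" unfolding realized_types_def by auto
  obtain x where x: "x \<in> type_points \<tau> n M p" using pq(1) unfolding realized_types_def by blast
  then have xn: "x \<in> {1..n}" unfolding type_points_def by simp
  have le: "type_count \<tau> n M p \<le> type_count \<tau> n M q"
    using assms(3) assms(5)[of "l - 1" l] unfolding p_def q_def by simp
  define N where "N = move_point x q M"
  note tp = type_points_move_point[OF xn sub(2), of _ M, folded N_def]
  have cp: "type_count \<tau> n N p = type_count \<tau> n M p - 1"
    using x pq(3) sub(1) unfolding type_count_def by (simp add: tp)
  \<comment> \<open>Makes the subtraction in \<open>cp\<close> genuine: the count of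
    \<open>p\<close> really drops, so \<open>N\<close> is not isomorphic to
    \<open>M\<close>.\<close>
  have cpos: "type_count \<tau> n M p > 0"
    using x finite_type_points unfolding type_count_def by (metis card_gt_0_iff empty_iff)
  have cq: "type_count \<tau> n N q \<ge> type_count \<tau> n M q"
    using sub(2) unfolding type_count_def
    by (auto simp: tp intro!: card_mono finite_type_points)
  have other: "type_count \<tau> n N r = type_count \<tau> n M r" if "r \<subseteq> \<tau>" "r \<noteq> p" "r \<noteq> q" for r
  proof -
    have "x \<notin> type_points \<tau> n M r" using x that sub unfolding type_points_def by blast
    then show ?thesis using that unfolding type_count_def by (simp add: tp)
  qed
  \<comment> \<open>With m the count of \<open>p\<close> in \<open>M\<close>, that of
    \<open>p\<close> drops to m - 1, while \<open>q\<close> has at least m points in both models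
    because it is the largest type. This fixes the threshold m - 1.\<close>
  have sim: "similar_counts \<tau> n (type_count \<tau> n M p - 1) M N"
    unfolding similar_counts_def
  proof (intro allI impI)
    fix r assume "r \<subseteq> \<tau>"
    then show "type_count \<tau> n M r = type_count \<tau> n N r \<or>
      type_count \<tau> n M p - 1 \<le> type_count \<tau> n M r \<and> type_count \<tau> n M p - 1 \<le> type_count \<tau> n N r"
      using other[of r] cp cq le by (cases "r = p"; cases "r = q") auto
  qed
  have "is_model \<tau> n N"
    using assms(2) xn unfolding is_model_def N_def move_point_def by auto
  moreover have "\<not> isomorphic_models \<tau> n M N"
    using isomorphic_models_type_count[of \<tau> n M N p] cp cpos by auto
  moreover have "isomorphic_models \<tau> n M M"
    unfolding isomorphic_models_def by (intro exI[of _ id]) auto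
  ultimately have "satisfies n M \<phi> \<noteq> satisfies n N \<phi>" "is_sentence \<tau> \<phi>"
    if "defines_model \<tau> n M \<phi>" for \<phi>
    using that assms(2) unfolding defines_model_def by auto
  then have bound: "3 * (type_count \<tau> n M p - 1) \<le> fo_size \<phi>" if "defines_model \<tau> n M \<phi>" for \<phi>
    using that fo_size_distinguishing[OF sim] by blast
  \<comment> \<open>The domain contains \<open>x\<close>, so \<open>n \<ge> 1\<close> and a defining
    sentence exists; the minimum is then the size of an actual one, to which \<open>bound\<close>
    applies.\<close>
  have "\<exists>k \<phi>. defines_model \<tau> n M \<phi> \<and> fo_size \<phi> = k"
    using defining_sentence_exists[OF assms(1)] xn by fastforce
  from LeastI_ex[OF this]
  obtain \<phi> where "defines_model \<tau> n M \<phi>" "fo_size \<phi> = description_complexity \<tau> n M"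
    unfolding description_complexity_def by blast
  then show ?thesis using bound cpos unfolding p_def by fastforce
qed

end
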